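(* Let $m=\{m(p)\}_{p=0}^{\infty}$ be a strongly regular sequence, let $n$ be a positive integer, and let $\omega_\ell,c_\ell\in\mathbb{C}$ for $1\le \ell\le n$, with $c_j\ne 0$ for some $1\le j\le n$. Consider the functional equation $$c_1\tau_{\omega_1,m}y(z)+c_2\tau_{\omega_2,m}y(z)+\cdots+c_n\tau_{\omega_n,m}y(z)=0. \qquad ( * )$$ Then the following statements hold: (i) The set of entire solutions $y$ to $( * )$ is a vector space over $\mathbb{C}$. (ii) Let $E_m(z)=\sum_{p=0}^{\infty}\frac{z^p}{m(p)}$, which is an entire function, and let $f$ be the entire function $$f(z)=c_1E_m(\omega_1z)+\cdots+c_nE_m(\omega_nz).$$ For every $z_0\in\mathbb{C}$ such that $f(z_0)=0$, the function $y(z)=E_m(z_0z)$ is an entire solution to $( * )$. (iii) Let $\{z_{0,1},\ldots,z_{0,N}\}$ be a set of $N$ different roots of $f$. Then $\{E_m(z_{0,1}z),\ldots,E_m(z_{0,N}z)\}$ is a set of $N$ linearly independent solutions to $( * )$.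
   Context: A sequence $\{M_p\}_{p=0}^{\infty}$ of positive real numbers with $M_0=1$ is called a strongly regular sequence if it satisfies: (lc) $M_p^2\le M_{p-1}M_{p+1}$ for every $p\ge 1$; (mg) there exists $A_1>0$ such that $M_{p+q}\le A_1^{p+q}M_pM_q$ for all integers $p,q\ge 0$; (snq) there exists $A_2>0$ such that $\sum_{q\ge p}\frac{M_q}{(q+1)M_{q+1}}\le A_2\frac{M_p}{M_{p+1}}$ for every $p\ge 0$. For a sequence $m=\{m(p)\}_{p\ge0}$ of positive real numbers, the moment derivative $\partial_m$ of a formal power series $\sum_{p\ge 0}a_p\frac{z^p}{m(p)}$ with complex coefficients is $\sum_{p\ge 1}a_p\frac{z^{p-1}}{m(p-1)}$. It is extended to functions holomorphic near the origin (in particular entire functions) by applying it to their Taylor expansion at $0$; $\partial_m^p$ denotes its $p$-th iterate. For $\omega\in\mathbb{C}$, the $m$-translation operator is $\tau_{\omega,m}y(z)=\sum_{p=0}^{\infty}\frac{\omega^p}{m(p)}\partial_m^p y(z)$. *)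

theory Defs
  imports "HOL-Complex_Analysis.Complex_Analysis" "HOL-Library.Function_Algebras"
begin

definition strongly_regular :: "(nat \<Rightarrow> real) \<Rightarrow> bool" where
  "strongly_regular M \<longleftrightarrow>
     (\<forall>p. M p > 0) \<and> M 0 = 1 \<and>
     (\<forall>p\<ge>1. (M p)\<^sup>2 \<le> M (p - 1) * M (p + 1)) \<and>
     (\<exists>A\<^sub>1>0. \<forall>p q. M (p + q) \<le> A\<^sub>1 ^ (p + q) * M p * M q) \<and>
     (\<exists>A\<^sub>2>0. \<forall>p.
        (\<lambda>q. M q / (real (q + 1) * M (q + 1))) summable_on {p..} \<and>
        (\<Sum>\<^sub>\<infinity>q\<in>{p..}. M q / (real (q + 1) * M (q + 1))) \<le> A\<^sub>2 * (M p / M (p + 1)))"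

(* Writing the coefficient of z^p as a p / m p means a p = m p * fps_nth F p. *)
definition fps_moment_deriv :: "(nat \<Rightarrow> real) \<Rightarrow> complex fps \<Rightarrow> complex fps" where
  "fps_moment_deriv m F =
     Abs_fps (\<lambda>p. of_real (m (Suc p)) * fps_nth F (Suc p) / of_real (m p))"

definition moment_deriv :: "(nat \<Rightarrow> real) \<Rightarrow> (complex \<Rightarrow> complex) \<Rightarrow> complex \<Rightarrow> complex" where
  "moment_deriv m y = eval_fps (fps_moment_deriv m (fps_expansion y 0))"

definition translation_term ::
    "(nat \<Rightarrow> real) \<Rightarrow> complex \<Rightarrow> (complex \<Rightarrow> complex) \<Rightarrow> complex \<Rightarrow> nat \<Rightarrow> complex" where
  "translation_term m \<omega> y z p = \<omega> ^ p / of_real (m p) * (moment_deriv m ^^ p) y z"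

definition moment_translation ::
    "(nat \<Rightarrow> real) \<Rightarrow> complex \<Rightarrow> (complex \<Rightarrow> complex) \<Rightarrow> complex \<Rightarrow> complex" where
  "moment_translation m \<omega> y z = (\<Sum>p. translation_term m \<omega> y z p)"

(* The summability clause says that the translations in the equation are defined at all
   (suminf of a divergent series is an unspecified value). For strongly regular m it excludes
   no entire y, because of the bound m (k + p) \<le> A ^ (k + p) * m k * m p. *)
definition entire_solutions ::
    "(nat \<Rightarrow> real) \<Rightarrow> nat \<Rightarrow> (nat \<Rightarrow> complex) \<Rightarrow> (nat \<Rightarrow> complex) \<Rightarrow> (complex \<Rightarrow> complex) set" where
  "entire_solutions m n c \<omega> =
     {y. y holomorphic_on UNIV \<and>
         (\<forall>l\<in>{1..n}. \<forall>z. summable (translation_term m (\<omega> l) y z)) \<and>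
         (\<forall>z. (\<Sum>l=1..n. c l * moment_translation m (\<omega> l) y z) = 0)}"

definition moment_exp :: "(nat \<Rightarrow> real) \<Rightarrow> complex \<Rightarrow> complex" where
  "moment_exp m z = (\<Sum>p. z ^ p / of_real (m p))"

(* Addition on functions is the pointwise one of Function_Algebras. *)
definition scale_fun :: "complex \<Rightarrow> (complex \<Rightarrow> complex) \<Rightarrow> complex \<Rightarrow> complex" where
  "scale_fun a y = (\<lambda>z. a * y z)"

interpretation cfun: vector_space scale_fun
  by unfold_locales (auto simp: scale_fun_def fun_eq_iff algebra_simps)

end

theory Submission
  imports Defs
begin

text \<open>
  The reason behind all three statements is that \<open>z \<mapsto> E (a z)\<close>, where \<open>E\<close> is the moment
  exponential, is an eigenfunction of the moment derivative with eigenvalue \<open>a\<close>. Hence a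
  translation by \<open>\<omega>\<close> multiplies it by \<open>\<Sum>p. (\<omega> a)\<^sup>p / m p = E (\<omega> a)\<close>
  (\<open>moment_translation_moment_exp\<close>), and the left-hand side of the equation multiplies it by
  \<open>f a\<close>; this vanishes precisely when \<open>a\<close> is a root of \<open>f\<close>.

  Two analytic facts make the argument legitimate. The convergent series in (snq) forces
  the quotients \<open>m (p + 1) / m p\<close>, which increase by (lc), to tend to infinity, so that \<open>E\<close> is
  entire (\<open>strongly_regular_ratio_at_top\<close>). By (mg) the same quotients grow at most
  geometrically, so that the moment derivative of an entire function is entire
  (\<open>fps_conv_radius_moment_deriv\<close>). All iterates therefore stay in the space of entire functions,
  where a function and its Taylor series determine each other and the moment derivative is
  visibly linear; linearity gives the vector space structure of the set of solutions.

  For the independence, comparing Taylor coefficients turns a relation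
  \<open>\<Sum>a. u a * E (a z) = 0\<close> into \<open>\<Sum>a. u a * a\<^sup>p = 0\<close> for all \<open>p\<close>, hence into
  \<open>\<Sum>a. u a * P a = 0\<close> for all polynomials \<open>P\<close>. A polynomial that vanishes at all but one of
  the finitely many points isolates one coefficient (\<open>power_sums_zero_imp_zero\<close>).
\<close>

section \<open>Growth of strongly regular sequences\<close>

lemma strongly_regular_pos: "strongly_regular m \<Longrightarrow> m p > 0"
  by (simp add: strongly_regular_def)

lemma strongly_regular_ratio_le:
  assumes "strongly_regular m"
  shows "m (Suc p) / m p \<le> m (Suc (Suc p)) / m (Suc p)"
proof -
  have pos: "m q > 0" for q
    using assms by (rule strongly_regular_pos)
  have "\<forall>p\<ge>1. (m p)\<^sup>2 \<le> m (p - 1) * m (p + 1)"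
    using assms unfolding strongly_regular_def by blast
  from this[rule_format, of "Suc p"] have "(m (Suc p))\<^sup>2 \<le> m p * m (Suc (Suc p))"
    by simp
  then show ?thesis
    using pos[of p] pos[of "Suc p"] by (simp add: field_simps power2_eq_square)
qed

text \<open>
  If the quotients stayed below \<open>C\<close>, the series in (snq) would dominate \<open>1 / C\<close> times the
  harmonic series. As they increase, being unbounded means tending to infinity.
\<close>
lemma strongly_regular_ratio_at_top:
  assumes "strongly_regular m"
  shows "filterlim (\<lambda>p. m (Suc p) / m p) at_top sequentially"
proof -
  have pos: "m q > 0" for q
    using assms by (rule strongly_regular_pos)
  have "incseq (\<lambda>p. m (Suc p) / m p)"
    using strongly_regular_ratio_le[OF assms] by (rule incseq_SucI)
  moreover have "\<exists>p. m (Suc p) / m p \<ge> C" for C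
  proof (rule ccontr)
    assume "\<not> ?thesis"
    then have less: "m (Suc p) / m p < C" for p
      by (simp add: not_le)
    have "C > 0"
      using less[of 0] pos[of 0] pos[of 1] by (smt (verit) One_nat_def divide_pos_pos)
    have "(\<lambda>q. m q / (real (q + 1) * m (q + 1))) summable_on {0..}"
      using assms unfolding strongly_regular_def by blast
    then have "summable (\<lambda>q. m q / (real (q + 1) * m (q + 1)))"
      by (intro summable_on_imp_summable) simp
    then have sm: "summable (\<lambda>q. C * (m q / (real (q + 1) * m (q + 1))))"
      by (rule summable_mult)
    have "inverse (real (Suc q)) \<le> C * (m q / (real (q + 1) * m (q + 1)))" for q
    proof -
      have "m (Suc q) \<le> C * m q"
        using less[of q] pos[of q] by (simp add: field_simps)
      then have "1 \<le> C * m q / m (Suc q)"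
        using pos[of "Suc q"] by simp
      from mult_left_mono[OF this, of "inverse (real (Suc q))"] show ?thesis
        by (simp add: field_simps)
    qed
    then have "summable (\<lambda>q. inverse (real (Suc q)))"
      by (intro summable_comparison_test'[OF sm, of 0]) simp
    then have "summable (\<lambda>q. inverse (real q))"
      by (rule summable_Suc_iff[THEN iffD1])
    then show False
      using not_summable_harmonic[where 'a = real] by simp
  qed
  ultimately show ?thesis
    unfolding filterlim_at_top eventually_sequentially incseq_def by (meson order_trans)
qed

text \<open>This is (mg) with \<open>q = 1\<close>.\<close>
lemma strongly_regular_geometric_ratio_bound:
  assumes "strongly_regular m"
  obtains A where "A > 0" "\<And>p. m (Suc p) / m p \<le> m 1 * A ^ Suc p"
proof -
  obtain A where A: "A > 0" "\<And>p q. m (p + q) \<le> A ^ (p + q) * m p * m q"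
    using assms unfolding strongly_regular_def by blast
  have "m (Suc p) / m p \<le> m 1 * A ^ Suc p" for p
    using A(2)[of p 1] strongly_regular_pos[OF assms, of p] by (simp add: field_simps)
  with A(1) show thesis
    by (rule that)
qed


section \<open>The moment derivative on entire functions\<close>

text \<open>
  Entire functions are handled through their Taylor series: this lemma passes from the function
  to a series, and \<open>fps_expansion_eval_fps\<close> below shows that evaluation loses nothing.
\<close>
lemma entire_eq_eval_fps:
  assumes "y holomorphic_on UNIV"
  obtains F where "fps_conv_radius F = \<infinity>" "y = eval_fps F"
proof
  have holo: "y holomorphic_on eball 0 \<infinity>"
    using assms by (rule holomorphic_on_subset) simp
  show "fps_conv_radius (fps_expansion y 0) = \<infinity>"
    using conv_radius_fps_expansion[OF holo] by simp
  show "y = eval_fps (fps_expansion y 0)"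
    using eval_fps_expansion'[OF holo] by (auto simp: fun_eq_iff)
qed

lemma fps_expansion_eval_fps:
  assumes "fps_conv_radius F > 0"
  shows "fps_expansion (eval_fps F) 0 = F"
  using fps_nth_fps_expansion[OF eval_fps_has_fps_expansion[OF assms]]
  by (simp add: fps_expansion_def fps_eq_iff)

lemma moment_deriv_eval_fps:
  "fps_conv_radius F > 0 \<Longrightarrow> moment_deriv m (eval_fps F) = eval_fps (fps_moment_deriv m F)"
  by (simp add: moment_deriv_def fps_expansion_eval_fps)

lemma fps_moment_deriv_add:
  "fps_moment_deriv m (F + G) = fps_moment_deriv m F + fps_moment_deriv m G"
  by (simp add: fps_moment_deriv_def fps_eq_iff ring_distribs add_divide_distrib)

lemma fps_moment_deriv_cmult:
  "fps_moment_deriv m (fps_const a * F) = fps_const a * fps_moment_deriv m F"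
  by (simp add: fps_moment_deriv_def fps_eq_iff)

lemma fps_moment_deriv_iterate_add:
  "(fps_moment_deriv m ^^ p) (F + G) = (fps_moment_deriv m ^^ p) F + (fps_moment_deriv m ^^ p) G"
  by (induction p) (simp_all add: fps_moment_deriv_add)

lemma fps_moment_deriv_iterate_cmult:
  "(fps_moment_deriv m ^^ p) (fps_const a * F) = fps_const a * (fps_moment_deriv m ^^ p) F"
  by (induction p) (simp_all add: fps_moment_deriv_cmult)

text \<open>
  The \<open>p\<close>-th coefficient of the new series at radius \<open>r \<ge> 1\<close> is at most a constant times the
  \<open>(p + 1)\<close>-st term of the old one at radius \<open>r A\<close>, by the geometric bound on the quotients.
\<close>
lemma fps_conv_radius_moment_deriv:
  assumes m: "strongly_regular m" and F: "fps_conv_radius F = \<infinity>"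
  shows "fps_conv_radius (fps_moment_deriv m F) = \<infinity>"
  unfolding fps_conv_radius_def
proof (rule conv_radius_inftyI'')
  fix z :: complex
  obtain A where A: "A > 0" "\<And>p. m (Suc p) / m p \<le> m 1 * A ^ Suc p"
    using strongly_regular_geometric_ratio_bound[OF m] by blast
  have pos: "m q > 0" for q
    using m by (rule strongly_regular_pos)
  \<comment> \<open>The maximum with 1 absorbs the shift from exponent \<open>p\<close> to \<open>p + 1\<close>.\<close>
  define w where "w = max 1 (cmod z) * A"
  have "summable (\<lambda>p. norm (fps_nth F p * of_real w ^ p))"
    using F by (intro norm_summable_fps) simp
  then have "summable (\<lambda>p. norm (fps_nth F (Suc p) * of_real w ^ Suc p))"
    by (rule summable_Suc_iff[THEN iffD2])
  then have sm: "summable (\<lambda>p. m 1 * norm (fps_nth F (Suc p) * of_real w ^ Suc p))"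
    by (rule summable_mult)
  show "summable (\<lambda>p. fps_nth (fps_moment_deriv m F) p * z ^ p)"
  proof (rule summable_comparison_test'[OF sm, of 0])
    fix p :: nat
    have "cmod z ^ p \<le> max 1 (cmod z) ^ p"
      by (intro power_mono) auto
    also have "\<dots> \<le> max 1 (cmod z) ^ Suc p"
      by (intro power_increasing) auto
    finally have z: "cmod z ^ p \<le> max 1 (cmod z) ^ Suc p" .
    have "norm (fps_nth (fps_moment_deriv m F) p * z ^ p)
        = norm (fps_nth F (Suc p)) * ((m (Suc p) / m p) * cmod z ^ p)"
      using pos[of p] pos[of "Suc p"]
      by (simp add: fps_moment_deriv_def norm_mult norm_divide norm_power)
    also have "\<dots> \<le> norm (fps_nth F (Suc p)) * ((m 1 * A ^ Suc p) * max 1 (cmod z) ^ Suc p)"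
      using pos[of 1] A(1) A(2)[of p] z
      by (intro mult_left_mono mult_mono) auto
    also have "\<dots> = m 1 * norm (fps_nth F (Suc p) * of_real w ^ Suc p)"
      using A(1) unfolding w_def
      by (simp only: norm_mult norm_power norm_of_real abs_mult power_mult_distrib) simp
    finally show "norm (fps_nth (fps_moment_deriv m F) p * z ^ p)
        \<le> m 1 * norm (fps_nth F (Suc p) * of_real w ^ Suc p)" .
  qed
qed

lemma fps_conv_radius_moment_deriv_iterate:
  assumes "strongly_regular m" "fps_conv_radius F = \<infinity>"
  shows "fps_conv_radius ((fps_moment_deriv m ^^ p) F) = \<infinity>"
  using assms by (induction p) (simp_all add: fps_conv_radius_moment_deriv)

lemma moment_deriv_iterate_eval_fps:
  assumes "strongly_regular m" "fps_conv_radius F = \<infinity>"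
  shows "(moment_deriv m ^^ p) (eval_fps F) = eval_fps ((fps_moment_deriv m ^^ p) F)"
  using assms
  by (induction p) (simp_all add: moment_deriv_eval_fps fps_conv_radius_moment_deriv_iterate)


section \<open>The solution space\<close>

lemma translation_term_add:
  assumes m: "strongly_regular m" and "y holomorphic_on UNIV" "w holomorphic_on UNIV"
  shows "translation_term m \<omega> (y + w) z p = translation_term m \<omega> y z p + translation_term m \<omega> w z p"
proof -
  obtain F where F: "fps_conv_radius F = \<infinity>" "y = eval_fps F"
    using assms(2) by (rule entire_eq_eval_fps)
  obtain G where G: "fps_conv_radius G = \<infinity>" "w = eval_fps G"
    using assms(3) by (rule entire_eq_eval_fps)
  have FG: "y + w = eval_fps (F + G)"
    by (simp add: F G eval_fps_add fun_eq_iff)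
  have "fps_conv_radius (F + G) = \<infinity>"
    using fps_conv_radius_add[of F G] F(1) G(1) by simp
  then show ?thesis
    unfolding translation_term_def FG moment_deriv_iterate_eval_fps[OF m \<open>fps_conv_radius (F + G) = \<infinity>\<close>]
    by (simp add: F G m moment_deriv_iterate_eval_fps fps_moment_deriv_iterate_add eval_fps_add
        fps_conv_radius_moment_deriv_iterate ring_distribs add_divide_distrib)
qed

lemma translation_term_scale:
  assumes m: "strongly_regular m" and "y holomorphic_on UNIV"
  shows "translation_term m \<omega> (scale_fun a y) z p = a * translation_term m \<omega> y z p"
proof -
  obtain F where F: "fps_conv_radius F = \<infinity>" "y = eval_fps F"
    using assms(2) by (rule entire_eq_eval_fps)
  have aF: "scale_fun a y = eval_fps (fps_const a * F)"
    by (simp add: F scale_fun_def eval_fps_mult fun_eq_iff)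
  have "fps_conv_radius (fps_const a * F) = \<infinity>"
    using fps_conv_radius_mult[of "fps_const a" F] F(1) by simp
  then show ?thesis
    unfolding translation_term_def aF moment_deriv_iterate_eval_fps[OF m \<open>fps_conv_radius (fps_const a * F) = \<infinity>\<close>]
    by (simp add: F m moment_deriv_iterate_eval_fps fps_moment_deriv_iterate_cmult eval_fps_mult
        fps_conv_radius_moment_deriv_iterate)
qed

text \<open>
  The terms of a translation are linear in the function; membership in the solution set
  provides the convergence that carries this over to the infinite sums.
\<close>
theorem subspace_entire_solutions:
  assumes m: "strongly_regular m"
  shows "cfun.subspace (entire_solutions m n c \<omega>)"
proof (rule cfun.subspaceI)
  \<comment> \<open>The zero function is 0 times itself, so homogeneity applies.\<close>
  have "translation_term m w 0 z p = 0" for w z p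
    using translation_term_scale[OF m, of 0 w 0 z p] by (simp add: scale_fun_def zero_fun_def)
  then have "translation_term m w 0 z = (\<lambda>p. 0)" for w z
    by (simp add: fun_eq_iff)
  then show "0 \<in> entire_solutions m n c \<omega>"
    unfolding entire_solutions_def moment_translation_def by (simp add: zero_fun_def)
next
  fix y w
  assume y: "y \<in> entire_solutions m n c \<omega>" and w: "w \<in> entire_solutions m n c \<omega>"
  have holo: "y holomorphic_on UNIV" "w holomorphic_on UNIV"
    using y w by (auto simp: entire_solutions_def)
  note add = translation_term_add[OF m holo]
  have "moment_translation m (\<omega> l) (y + w) z
      = moment_translation m (\<omega> l) y z + moment_translation m (\<omega> l) w z" if "l \<in> {1..n}" for l z
    using y w that unfolding moment_translation_def add
    by (intro suminf_add[symmetric]) (auto simp: entire_solutions_def)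
  then have "(\<Sum>l=1..n. c l * moment_translation m (\<omega> l) (y + w) z)
      = (\<Sum>l=1..n. c l * moment_translation m (\<omega> l) y z)
        + (\<Sum>l=1..n. c l * moment_translation m (\<omega> l) w z)" for z
    unfolding sum.distrib[symmetric] by (intro sum.cong) (auto simp: ring_distribs)
  moreover have "(y + w) holomorphic_on UNIV"
    using holomorphic_on_add[OF holo] by (simp add: plus_fun_def)
  ultimately show "y + w \<in> entire_solutions m n c \<omega>"
    using y w by (auto simp: entire_solutions_def add[abs_def] intro!: summable_add)
next
  fix a y
  assume y: "y \<in> entire_solutions m n c \<omega>"
  have holo: "y holomorphic_on UNIV"
    using y by (auto simp: entire_solutions_def)
  note scale = translation_term_scale[OF m holo]
  have "moment_translation m (\<omega> l) (scale_fun a y) z = a * moment_translation m (\<omega> l) y z"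
    if "l \<in> {1..n}" for l z
    using y that unfolding moment_translation_def scale
    by (intro suminf_mult) (auto simp: entire_solutions_def)
  then have "(\<Sum>l=1..n. c l * moment_translation m (\<omega> l) (scale_fun a y) z)
      = a * (\<Sum>l=1..n. c l * moment_translation m (\<omega> l) y z)" for z
    unfolding sum_distrib_left by (intro sum.cong) auto
  moreover have "scale_fun a y holomorphic_on UNIV"
    unfolding scale_fun_def by (intro holomorphic_intros holo)
  ultimately show "scale_fun a y \<in> entire_solutions m n c \<omega>"
    using y by (auto simp: entire_solutions_def scale[abs_def] intro!: summable_mult)
qed


section \<open>Moment exponentials as eigenfunctions\<close>

definition moment_exp_fps :: "(nat \<Rightarrow> real) \<Rightarrow> complex \<Rightarrow> complex fps" where
  "moment_exp_fps m a = Abs_fps (\<lambda>p. a ^ p / of_real (m p))"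

lemma eval_moment_exp_fps: "eval_fps (moment_exp_fps m a) = (\<lambda>z. moment_exp m (a * z))"
  by (simp add: eval_fps_def moment_exp_fps_def moment_exp_def power_mult_distrib fun_eq_iff)

lemma summable_moment_exp:
  assumes "strongly_regular m"
  shows "summable (\<lambda>p. z ^ p / complex_of_real (m p))"
proof -
  have pos: "m q > 0" for q
    using assms by (rule strongly_regular_pos)
  have "(\<lambda>p. ereal (m (Suc p) / m p)) \<longlonglongrightarrow> \<infinity>"
    using strongly_regular_ratio_at_top[OF assms] by (simp add: tendsto_PInfty_eq_at_top)
  then have "(\<lambda>p. ereal (norm (1 / complex_of_real (m p)) / norm (1 / complex_of_real (m (Suc p)))))
      \<longlonglongrightarrow> \<infinity>"
    using pos by (simp add: norm_divide less_imp_le)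
  moreover have "1 / complex_of_real (m p) \<noteq> 0" for p
    using pos[of p] by simp
  ultimately have "conv_radius (\<lambda>p. 1 / complex_of_real (m p)) = \<infinity>"
    by (intro conv_radius_ratio_limit_ereal) auto
  then show ?thesis
    using summable_in_conv_radius[of z "\<lambda>p. 1 / complex_of_real (m p)"] by simp
qed

lemma fps_conv_radius_moment_exp_fps:
  assumes "strongly_regular m"
  shows "fps_conv_radius (moment_exp_fps m a) = \<infinity>"
  unfolding fps_conv_radius_def
proof (rule conv_radius_inftyI'')
  fix z
  show "summable (\<lambda>p. fps_nth (moment_exp_fps m a) p * z ^ p)"
    using summable_moment_exp[OF assms, of "a * z"]
    by (simp add: moment_exp_fps_def power_mult_distrib)
qed

lemma holomorphic_moment_exp:
  assumes "strongly_regular m"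
  shows "(\<lambda>z. moment_exp m (a * z)) holomorphic_on UNIV"
  unfolding eval_moment_exp_fps[symmetric]
  by (intro holomorphic_on_eval_fps) (simp add: fps_conv_radius_moment_exp_fps[OF assms])

text \<open>
  Multiplication by \<open>m (p + 1) / m p\<close> turns the coefficient \<open>a ^ (p + 1) / m (p + 1)\<close> into
  \<open>a * (a ^ p / m p)\<close>.
\<close>
lemma fps_moment_deriv_moment_exp_fps:
  assumes "strongly_regular m"
  shows "fps_moment_deriv m (moment_exp_fps m a) = fps_const a * moment_exp_fps m a"
  using strongly_regular_pos[OF assms]
  by (simp add: fps_moment_deriv_def moment_exp_fps_def fps_eq_iff less_imp_neq[symmetric])

lemma moment_deriv_iterate_moment_exp:
  assumes "strongly_regular m"
  shows "(moment_deriv m ^^ p) (\<lambda>z. moment_exp m (a * z)) = (\<lambda>z. a ^ p * moment_exp m (a * z))"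
proof -
  have "(fps_moment_deriv m ^^ p) (moment_exp_fps m a) = fps_const (a ^ p) * moment_exp_fps m a"
    by (induction p) (simp_all add: fps_moment_deriv_cmult fps_moment_deriv_moment_exp_fps[OF assms]
        mult.assoc[symmetric] mult.commute[of a])
  moreover have "eval_fps (fps_const (a ^ p) * moment_exp_fps m a) z = a ^ p * moment_exp m (a * z)" for z
    by (simp add: eval_fps_mult fps_conv_radius_moment_exp_fps[OF assms] eval_moment_exp_fps)
  ultimately show ?thesis
    using moment_deriv_iterate_eval_fps[OF assms fps_conv_radius_moment_exp_fps[OF assms], of p a]
    by (simp add: eval_moment_exp_fps fun_eq_iff)
qed

lemma translation_term_moment_exp:
  assumes "strongly_regular m"
  shows "translation_term m w (\<lambda>z. moment_exp m (a * z)) z p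
    = (w * a) ^ p / of_real (m p) * moment_exp m (a * z)"
  by (simp add: translation_term_def moment_deriv_iterate_moment_exp[OF assms] power_mult_distrib)

lemma moment_translation_moment_exp:
  assumes "strongly_regular m"
  shows "moment_translation m w (\<lambda>z. moment_exp m (a * z)) z
    = moment_exp m (w * a) * moment_exp m (a * z)"
  unfolding moment_translation_def translation_term_moment_exp[OF assms] moment_exp_def[of m "w * a"]
  by (rule suminf_mult2[symmetric]) (rule summable_moment_exp[OF assms])

theorem moment_exp_entire_solution:
  assumes m: "strongly_regular m"
    and root: "(\<Sum>l=1..n. c l * moment_exp m (\<omega> l * a)) = 0"
  shows "(\<lambda>z. moment_exp m (a * z)) \<in> entire_solutions m n c \<omega>"
proof -
  have "summable (translation_term m w (\<lambda>z. moment_exp m (a * z)) z)" for w z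
    unfolding translation_term_moment_exp[OF m, abs_def]
    by (intro summable_mult2 summable_moment_exp m)
  moreover have "(\<Sum>l=1..n. c l * moment_translation m (\<omega> l) (\<lambda>z. moment_exp m (a * z)) z)
      = (\<Sum>l=1..n. c l * moment_exp m (\<omega> l * a)) * moment_exp m (a * z)" for z
    unfolding moment_translation_moment_exp[OF m] sum_distrib_right by (simp add: mult.assoc)
  ultimately show ?thesis
    using holomorphic_moment_exp[OF m] root by (simp add: entire_solutions_def)
qed


section \<open>Linear independence of moment exponentials\<close>

text \<open>
  This is the invertibility of the Vandermonde matrix of distinct points, seen by testing against
  the unnormalised Lagrange polynomial of the point \<open>b\<close>.
\<close>
lemma power_sums_zero_imp_zero:
  fixes u :: "'a :: idom \<Rightarrow> 'a"
  assumes "finite T" and sums: "\<And>p. (\<Sum>a\<in>T. u a * a ^ p) = 0" and "b \<in> T"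
  shows "u b = 0"
proof -
  define P where "P = (\<Prod>a\<in>T - {b}. [:- a, 1:])"
  have P: "poly P x = (\<Prod>a\<in>T - {b}. x - a)" for x
    by (simp add: P_def poly_prod)
  have "(\<Sum>a\<in>T. u a * poly P a) = (\<Sum>i\<le>degree P. poly.coeff P i * (\<Sum>a\<in>T. u a * a ^ i))"
    unfolding poly_altdef sum_distrib_left by (subst sum.swap) (simp add: mult_ac)
  also have "\<dots> = 0"
    by (simp add: sums)
  also have "(\<Sum>a\<in>T. u a * poly P a) = u b * poly P b + (\<Sum>a\<in>T - {b}. u a * poly P a)"
    using assms by (intro sum.remove) auto
  also have "(\<Sum>a\<in>T - {b}. u a * poly P a) = 0"
    using assms(1) by (intro sum.neutral) (auto simp: P)
  finally show ?thesis
    using assms(1) by (auto simp: P)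
qed

lemma moment_exp_combination_zero:
  assumes m: "strongly_regular m" and T: "finite T"
    and zero: "\<And>z. (\<Sum>a\<in>T. u a * moment_exp m (a * z)) = 0" and "b \<in> T"
  shows "u b = 0"
proof (rule power_sums_zero_imp_zero[OF T _ \<open>b \<in> T\<close>])
  fix p
  have "eval_fps (moment_exp_fps m a) has_fps_expansion moment_exp_fps m a" for a
    by (rule eval_fps_has_fps_expansion) (simp add: fps_conv_radius_moment_exp_fps[OF m])
  then have "(\<lambda>z. \<Sum>a\<in>T. u a * eval_fps (moment_exp_fps m a) z)
      has_fps_expansion (\<Sum>a\<in>T. fps_const (u a) * moment_exp_fps m a)"
    by (intro fps_expansion_intros)
  then have "(\<lambda>z. 0) has_fps_expansion (\<Sum>a\<in>T. fps_const (u a) * moment_exp_fps m a)"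
    by (simp add: eval_moment_exp_fps zero)
  from fps_nth_fps_expansion[OF this] fps_nth_fps_expansion[OF has_fps_expansion_0]
  have "fps_nth (\<Sum>a\<in>T. fps_const (u a) * moment_exp_fps m a) p = 0"
    by simp
  then have "(\<Sum>a\<in>T. u a * a ^ p) / of_real (m p) = 0"
    by (simp add: fps_sum_nth moment_exp_fps_def sum_divide_distrib)
  then show "(\<Sum>a\<in>T. u a * a ^ p) = 0"
    using strongly_regular_pos[OF m, of p] by simp
qed

text \<open>
  Two equal functions \<open>E (a z)\<close> and \<open>E (b z)\<close> with \<open>a \<noteq> b\<close> would give the nontrivial relation
  with coefficients 1 and -1. Injectivity makes a set of such functions as large as its set of
  frequencies.
\<close>
lemma inj_moment_exp_scaling:
  assumes m: "strongly_regular m"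
  shows "inj (\<lambda>a z. moment_exp m (a * z))"
proof (rule injI, rule ccontr)
  fix a b
  assume eq: "(\<lambda>z. moment_exp m (a * z)) = (\<lambda>z. moment_exp m (b * z))" and "a \<noteq> b"
  define u :: "complex \<Rightarrow> complex" where "u x = (if x = a then 1 else - 1)" for x
  have "(\<Sum>x\<in>{a, b}. u x * moment_exp m (x * z)) = 0" for z
    using \<open>a \<noteq> b\<close> fun_cong[OF eq, of z] by (simp add: u_def)
  from moment_exp_combination_zero[OF m _ this, of a] show False
    by (simp add: u_def)
qed

lemma sum_fun_apply: "(\<Sum>x\<in>A. f x) z = (\<Sum>x\<in>A. f x z)"
  by (induction A rule: infinite_finite_induct) simp_all

theorem independent_moment_exp:
  assumes m: "strongly_regular m"
  shows "cfun.independent ((\<lambda>a z. moment_exp m (a * z)) ` A)"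
proof -
  let ?E = "\<lambda>a z. moment_exp m (a * z)"
  have "u v = 0" if "finite S" "S \<subseteq> ?E ` A" and zero: "(\<Sum>v\<in>S. scale_fun (u v) v) = 0" and "v \<in> S"
    for S u v
  proof -
    obtain T where T: "finite T" "S = ?E ` T"
      using \<open>finite S\<close> \<open>S \<subseteq> ?E ` A\<close> by (meson finite_subset_image)
    have inj: "inj_on ?E T"
      using inj_moment_exp_scaling[OF m] by (rule inj_on_subset) simp
    have "(\<Sum>a\<in>T. scale_fun (u (?E a)) (?E a)) = 0"
      using zero unfolding T(2) by (simp add: sum.reindex[OF inj])
    then have "(\<Sum>a\<in>T. u (?E a) * ?E a z) = 0" for z
      by (drule_tac x = z in fun_cong) (simp add: sum_fun_apply scale_fun_def)
    from moment_exp_combination_zero[OF m T(1) this] show ?thesis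
      using \<open>v \<in> S\<close> T(2) by blast
  qed
  then show ?thesis
    unfolding cfun.independent_explicit_module by blast
qed


section \<open>The functional equation\<close>

theorem theorem4p3:
  fixes m :: "nat \<Rightarrow> real" and n :: nat and \<omega> c :: "nat \<Rightarrow> complex"
    and f :: "complex \<Rightarrow> complex"
  assumes m: "strongly_regular m"
    and n: "n \<ge> 1"
    and c: "\<exists>j\<in>{1..n}. c j \<noteq> 0"
    and f: "f = (\<lambda>z. \<Sum>l=1..n. c l * moment_exp m (\<omega> l * z))"
  shows "cfun.subspace (entire_solutions m n c \<omega>) \<and>
         ((\<forall>z. summable (\<lambda>p. z ^ p / complex_of_real (m p))) \<and>
          moment_exp m holomorphic_on UNIV \<and> f holomorphic_on UNIV \<and>
          (\<forall>z\<^sub>0. f z\<^sub>0 = 0 \<longrightarrow> (\<lambda>z. moment_exp m (z\<^sub>0 * z)) \<in> entire_solutions m n c \<omega>)) \<and>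
         (\<forall>(N::nat) z\<^sub>0. inj_on z\<^sub>0 {1..N} \<and> (\<forall>i\<in>{1..N}. f (z\<^sub>0 i) = 0) \<longrightarrow>
           (let S = (\<lambda>i z. moment_exp m (z\<^sub>0 i * z)) ` {1..N} in
              S \<subseteq> entire_solutions m n c \<omega> \<and> card S = N \<and> cfun.independent S))"
proof (intro conjI allI impI)
  show "cfun.subspace (entire_solutions m n c \<omega>)"
    by (rule subspace_entire_solutions[OF m])
  show "summable (\<lambda>p. z ^ p / complex_of_real (m p))" for z
    by (rule summable_moment_exp[OF m])
  show "moment_exp m holomorphic_on UNIV"
    using holomorphic_moment_exp[OF m, of 1] by simp
  show "f holomorphic_on UNIV"
    unfolding f by (intro holomorphic_intros holomorphic_moment_exp[OF m])
  show sol: "(\<lambda>z. moment_exp m (z\<^sub>0 * z)) \<in> entire_solutions m n c \<omega>" if "f z\<^sub>0 = 0" for z\<^sub>0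
    using that unfolding f by (rule moment_exp_entire_solution[OF m])
  fix N and z\<^sub>0 :: "nat \<Rightarrow> complex"
  assume roots: "inj_on z\<^sub>0 {1..N} \<and> (\<forall>i\<in>{1..N}. f (z\<^sub>0 i) = 0)"
  have S: "(\<lambda>i z. moment_exp m (z\<^sub>0 i * z)) ` {1..N} = (\<lambda>a z. moment_exp m (a * z)) ` z\<^sub>0 ` {1..N}"
    by (simp add: image_image)
  have "card ((\<lambda>a z. moment_exp m (a * z)) ` z\<^sub>0 ` {1..N}) = N"
    using roots inj_on_subset[OF inj_moment_exp_scaling[OF m]] by (simp add: card_image)
  then show "let S = (\<lambda>i z. moment_exp m (z\<^sub>0 i * z)) ` {1..N} in
      S \<subseteq> entire_solutions m n c \<omega> \<and> card S = N \<and> cfun.independent S"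
    using roots sol independent_moment_exp[OF m] unfolding S Let_def by auto
qed

end
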